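(* Let $n,m,N\ge 1$ be integers, $T>0$, $A\subseteq\mathbb{R}^m$ a compact set, $F:\mathbb{R}^n\times A\to\mathbb{R}^n$ a continuous map, and $h:\mathbb{R}^n\times A\to\mathbb{R}^N$, $g:\mathbb{R}^n\to\mathbb{R}^N$ given maps. Assume there is a constant $C$ such that for all $x,y\in\mathbb{R}^n$ and $a\in A$: $|F(x,a)|,|g(x)|,|h(x,a)|\le C$, $|F(x,a)-F(y,a)|\le C|x-y|$, $|g(x)-g(y)|\le C|x-y|$ and $|h(x,a)-h(y,a)|\le C|x-y|$. Let $\le_K$ be a partial ordering on $\mathbb{R}^N$ generated by a proper cone $K\subseteq\mathbb{R}^N$, and let $K^*$ be the dual cone of $K$. Let $C_{x,t}[\alpha]$ denote the vectorial cost of the control $\alpha\in\mathcal{A}$ and $S_{x,t}$ the closure of the set of attainable costs (see context). Then for any $\lambda\in K^*$ there exists a vectorial value function $u^\lambda:\mathbb{R}^n\times(0,T)\to\mathbb{R}^N$ which is a Pareto Minimal of the vectorial cost with respect to the ordering $\le_K$ and also satisfies $$\lambda\cdot u^\lambda(x,t)=\inf_{\alpha\in\mathcal{A}}\big\{\lambda\cdot C_{x,t}[\alpha]\big\},\qquad x\in\mathbb{R}^n,\ 0<t<T .$$ The scalar function $\lambda\cdot u^\lambda$ is the projection of the vectorial value map $u^\lambda$ along the direction generated by a supporting hyperplane of $S_{x,t}$ normal to $\lambda$. In addition, $\lambda\cdot u^\lambda$ is bounded and Lipschitz continuous in both variables.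
   Context: A cone $K\subseteq\mathbb{R}^N$ is a non-empty set such that $\xi\in K$ implies $t\xi\in K$ for any $t\ge 0$. It is a proper cone if it is closed and convex, has non-empty interior, and $\xi\in K$ and $-\xi\in K$ imply $\xi=0$. It induces the partial ordering $\xi\le_K\eta \iff \eta-\xi\in K$. Its dual cone is $K^*=\{\eta\in\mathbb{R}^N : \eta\cdot\xi\ge 0 \text{ for all } \xi\in K\}$. The admissible controls are $\mathcal{A}=\{\alpha\in L^\infty(0,T) : \alpha(t)\in A \text{ for a.e. } t\in(0,T)\}$. For $(x,t)\in\mathbb{R}^n\times(0,T)$ and $\alpha\in\mathcal{A}$, let $\chi$ be the solution of $\dot\chi(s)=F(\chi(s),\alpha(s))$ for $t<s<T$, $\chi(t)=x$. The vectorial cost functional is $$C_{x,t}[\alpha]=g(\chi(T))+\int_t^T h(\chi(s),\alpha(s))\,ds\in\mathbb{R}^N .$$ Set $S_{x,t}=\overline{\{C_{x,t}[\alpha] : \alpha\in\mathcal{A}\}}\subseteq\mathbb{R}^N$. A map $u:\mathbb{R}^n\times(0,T)\to\mathbb{R}^N$ is a Pareto Minimal of the cost (a vectorial value function, or value map) if for every $(x,t)\in\mathbb{R}^n\times(0,T)$ one has $u(x,t)\in S_{x,t}$ and, for all $\eta\in S_{x,t}$ with $\eta\le_K u(x,t)$, $\eta=u(x,t)$. *)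

theory Defs
  imports "HOL-Analysis.Analysis"
begin

definition proper_cone :: "'a::euclidean_space set \<Rightarrow> bool" where
  "proper_cone K \<longleftrightarrow> K \<noteq> {} \<and> cone K \<and> closed K \<and> convex K \<and> interior K \<noteq> {} \<and>
     (\<forall>\<xi>. \<xi> \<in> K \<and> - \<xi> \<in> K \<longrightarrow> \<xi> = 0)"

definition cone_le :: "'a::euclidean_space set \<Rightarrow> 'a \<Rightarrow> 'a \<Rightarrow> bool" where
  "cone_le K \<xi> \<eta> \<longleftrightarrow> \<eta> - \<xi> \<in> K"

definition dual_cone :: "'a::euclidean_space set \<Rightarrow> 'a set" where
  "dual_cone K = {\<eta>. \<forall>\<xi>\<in>K. \<eta> \<bullet> \<xi> \<ge> 0}"

text \<open>Controls are represented by functions on the line rather than by almost-everywhere classes;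
  only the restriction to the interval \<open>(0,T)\<close> matters.  The second conjunct is essential
  boundedness, so the first two say that \<open>\<alpha>\<close> represents an element of \<open>L\<^sup>\<infinity>(0,T)\<close>.\<close>

definition controls :: "(real ^ 'm) set \<Rightarrow> real \<Rightarrow> (real \<Rightarrow> real ^ 'm) set" where
  "controls A T = {\<alpha>. \<alpha> \<in> borel_measurable (lebesgue_on {0<..<T}) \<and>
     (\<exists>B. AE s in lebesgue_on {0<..<T}. norm (\<alpha> s) \<le> B) \<and>
     (AE s in lebesgue_on {0<..<T}. \<alpha> s \<in> A)}"

text \<open>Controls are merely measurable, so the state equation is understood in the sense of
  Caratheodory: \<open>y\<close> is a continuous function satisfying the integrated equation on \<open>[t,T]\<close>.
  The trajectory is made unique as a function on the line by requiring it to be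
  \<open>undefined\<close> outside \<open>[t,T]\<close>.\<close>

definition solves_state_eq ::
    "(real ^ 'n \<Rightarrow> real ^ 'm \<Rightarrow> real ^ 'n) \<Rightarrow> real \<Rightarrow> real ^ 'n \<Rightarrow> real \<Rightarrow>
     (real \<Rightarrow> real ^ 'm) \<Rightarrow> (real \<Rightarrow> real ^ 'n) \<Rightarrow> bool" where
  "solves_state_eq F T x t \<alpha> y \<longleftrightarrow>
     continuous_on {t..T} y \<and>
     set_integrable lebesgue {t..T} (\<lambda>r. F (y r) (\<alpha> r)) \<and>
     (\<forall>s\<in>{t..T}. y s = x + (LINT r:{t..s}|lebesgue. F (y r) (\<alpha> r)))"

definition trajectory ::
    "(real ^ 'n \<Rightarrow> real ^ 'm \<Rightarrow> real ^ 'n) \<Rightarrow> real \<Rightarrow> real ^ 'n \<Rightarrow> real \<Rightarrow>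
     (real \<Rightarrow> real ^ 'm) \<Rightarrow> real \<Rightarrow> real ^ 'n" where
  "trajectory F T x t \<alpha> = (THE y. solves_state_eq F T x t \<alpha> y \<and> y \<in> extensional {t..T})"

definition cost ::
    "(real ^ 'n \<Rightarrow> real ^ 'm \<Rightarrow> real ^ 'n) \<Rightarrow> (real ^ 'n \<Rightarrow> real ^ 'm \<Rightarrow> real ^ 'N) \<Rightarrow>
     (real ^ 'n \<Rightarrow> real ^ 'N) \<Rightarrow> real \<Rightarrow> real ^ 'n \<Rightarrow> real \<Rightarrow> (real \<Rightarrow> real ^ 'm) \<Rightarrow> real ^ 'N" where
  "cost F h g T x t \<alpha> = (let y = trajectory F T x t \<alpha> in
     g (y T) + (LINT s:{t..T}|lebesgue. h (y s) (\<alpha> s)))"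

text \<open>The running cost \<open>h\<close> is not assumed continuous, or even measurable, in the control variable.
  The following condition says that the integral in the cost functional exists for all initial
  data and all controls; otherwise the Bochner integral would silently take the value 0.
  For \<open>h\<close> bounded and Lipschitz in the state (uniformly in the control), it holds in particular
  whenever \<open>h\<close> is Borel measurable in the control.\<close>

definition cost_well_defined ::
    "(real ^ 'n \<Rightarrow> real ^ 'm \<Rightarrow> real ^ 'n) \<Rightarrow> (real ^ 'n \<Rightarrow> real ^ 'm \<Rightarrow> real ^ 'N) \<Rightarrow>
     (real ^ 'm) set \<Rightarrow> real \<Rightarrow> bool" where
  "cost_well_defined F h A T \<longleftrightarrow>
     (\<forall>x. \<forall>t\<in>{0<..<T}. \<forall>\<alpha>\<in>controls A T.
        set_integrable lebesgue {t..T} (\<lambda>s. h (trajectory F T x t \<alpha> s) (\<alpha> s)))"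

definition attainable_costs ::
    "(real ^ 'n \<Rightarrow> real ^ 'm \<Rightarrow> real ^ 'n) \<Rightarrow> (real ^ 'n \<Rightarrow> real ^ 'm \<Rightarrow> real ^ 'N) \<Rightarrow>
     (real ^ 'n \<Rightarrow> real ^ 'N) \<Rightarrow> (real ^ 'm) set \<Rightarrow> real \<Rightarrow> real ^ 'n \<Rightarrow> real \<Rightarrow> (real ^ 'N) set" where
  "attainable_costs F h g A T x t = closure (cost F h g T x t ` controls A T)"

text \<open>Value maps live on \<open>\<real>\<^sup>n \<times> (0,T)\<close>; values at other times are irrelevant.\<close>

definition pareto_minimal ::
    "(real ^ 'N) set \<Rightarrow> (real ^ 'n \<Rightarrow> real ^ 'm \<Rightarrow> real ^ 'n) \<Rightarrow>
     (real ^ 'n \<Rightarrow> real ^ 'm \<Rightarrow> real ^ 'N) \<Rightarrow> (real ^ 'n \<Rightarrow> real ^ 'N) \<Rightarrow> (real ^ 'm) set \<Rightarrow> real \<Rightarrow>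
     (real ^ 'n \<Rightarrow> real \<Rightarrow> real ^ 'N) \<Rightarrow> bool" where
  "pareto_minimal K F h g A T u \<longleftrightarrow>
     (\<forall>x. \<forall>t\<in>{0<..<T}. u x t \<in> attainable_costs F h g A T x t \<and>
        (\<forall>\<eta>\<in>attainable_costs F h g A T x t. cone_le K \<eta> (u x t) \<longrightarrow> \<eta> = u x t))"

text \<open>\<open>H\<close> is a hyperplane normal to \<open>v\<close> that meets \<open>S\<close> and has \<open>S\<close> on the side into which \<open>v\<close> points.\<close>

definition supporting_hyperplane_normal_to ::
    "'a::euclidean_space set \<Rightarrow> 'a set \<Rightarrow> 'a \<Rightarrow> bool" where
  "supporting_hyperplane_normal_to S H v \<longleftrightarrow>
     v \<noteq> 0 \<and> H \<inter> S \<noteq> {} \<and> (\<exists>c. H = {\<xi>. v \<bullet> \<xi> = c} \<and> S \<subseteq> {\<xi>. c \<le> v \<bullet> \<xi>})"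

end

theory Submission
  imports Defs
begin

text \<open>
  The set of attainable costs is compact, being closed by definition and bounded because \<open>g\<close> and
  \<open>h\<close> are bounded, so \<open>\<lambda>\<xi>. l \<bullet> \<xi>\<close> attains its minimum on it.  When \<open>l\<close> lies on the boundary of the
  dual cone, a minimizer of \<open>l\<close> need not be Pareto minimal.  A second, lexicographic minimization
  cures this: a proper cone admits a functional \<open>\<mu>\<close> that is positive on all of \<open>K\<close> except \<open>0\<close>
  (\<open>proper_cone_strictly_positive_functional\<close>), and a minimizer \<open>u\<close> of \<open>\<mu>\<close> on the face where \<open>l\<close> is
  minimal is Pareto minimal (\<open>compact_cone_minimal_on_face\<close>), since any \<open>\<eta>\<close> below \<open>u\<close> lies on the
  same face and satisfies \<open>\<mu> \<bullet> (u - \<eta>) \<le> 0\<close>.  Passing to the closure does not change an infimum,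
  so \<open>l \<bullet> u\<close> is the scalar value function, whatever minimizer is chosen; the hyperplane through
  \<open>u\<close> normal to \<open>l\<close> supports the attainable set.

  The regularity of \<open>l \<bullet> u\<close> is thus that of an infimum of scalar costs, and boundedness and
  Lipschitz continuity pass to an infimum as soon as they hold uniformly in the control
  (\<open>cost_bounded\<close>, \<open>cost_lipschitz\<close>).  The latter rests on Lipschitz dependence of trajectories on
  the initial data.  Measuring the distance of two curves by
  \<open>SUP s. norm (y s - z s) / exp ((2 * C + 1) * s)\<close> makes the Picard operator of the state equation a
  contraction with constant \<open>1 / 2\<close> on the whole time interval (\<open>picard_contraction\<close>).  This one
  estimate gives existence of trajectories by Banach's theorem, and uniqueness and stability
  without a separate Gronwall inequality.  A shift of the initial time from \<open>t\<close> to \<open>t'\<close> is a shift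
  of the initial state: the first trajectory restarts at time \<open>t'\<close> from a point at distance at most
  \<open>C * (t' - t)\<close> from its start.
\<close>

section \<open>Minimal points of compact sets for a proper cone\<close>

text \<open>
  The sum of two nonzero elements of a pointed convex cone is nonzero, so \<open>K - {0}\<close> is convex.
  Hence the compact set \<open>convex hull (K \<inter> sphere 0 1)\<close> misses the origin and is strictly separated
  from it; the separating functional is positive on every ray of the cone.
\<close>

lemma proper_cone_strictly_positive_functional:
  fixes K :: "'a::euclidean_space set"
  assumes "proper_cone K"
  obtains \<mu> where "\<And>\<xi>. \<xi> \<in> K \<Longrightarrow> \<xi> \<noteq> 0 \<Longrightarrow> \<mu> \<bullet> \<xi> > 0"
proof -
  have K: "cone K" "closed K" "convex K" and pointed: "\<And>\<xi>. \<xi> \<in> K \<Longrightarrow> - \<xi> \<in> K \<Longrightarrow> \<xi> = 0"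
    using assms by (auto simp: proper_cone_def)
  have sub: "convex hull (K \<inter> sphere 0 1) \<subseteq> K - {0}"
  proof (rule hull_minimal)
    show "convex (K - {0})"
      unfolding convex_def
    proof (intro ballI allI impI)
      fix x y and a b :: real
      assume x: "x \<in> K - {0}" and y: "y \<in> K - {0}" and ab: "0 \<le> a" "0 \<le> b" "a + b = 1"
      have "a *\<^sub>R x \<in> K" "b *\<^sub>R y \<in> K"
        using K(1) x y ab by (auto simp: cone_def)
      moreover have "a *\<^sub>R x + b *\<^sub>R y \<in> K"
        using K(3) x y ab by (auto simp: convex_def)
      moreover have "a *\<^sub>R x + b *\<^sub>R y \<noteq> 0"
      proof
        assume 0: "a *\<^sub>R x + b *\<^sub>R y = 0"
        then have "- (a *\<^sub>R x) = b *\<^sub>R y" "- (b *\<^sub>R y) = a *\<^sub>R x"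
          by (simp_all add: add_eq_0_iff)
        then have "a *\<^sub>R x = 0" "b *\<^sub>R y = 0"
          using pointed \<open>a *\<^sub>R x \<in> K\<close> \<open>b *\<^sub>R y \<in> K\<close> by metis+
        with x y ab show False by auto
      qed
      ultimately show "a *\<^sub>R x + b *\<^sub>R y \<in> K - {0}" by simp
    qed
  qed auto
  have "compact (convex hull (K \<inter> sphere 0 1))"
    by (intro compact_convex_hull closed_Int_compact K) simp
  then obtain \<mu> b where b: "0 < b" and \<mu>: "\<And>\<xi>. \<xi> \<in> convex hull (K \<inter> sphere 0 1) \<Longrightarrow> \<mu> \<bullet> \<xi> > b"
    using separating_hyperplane_closed_0[of "convex hull (K \<inter> sphere 0 1)"] sub
      compact_imp_closed[OF \<open>compact (convex hull (K \<inter> sphere 0 1))\<close>] convex_convex_hull by blast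
  show thesis
  proof
    fix \<xi> assume \<xi>: "\<xi> \<in> K" "\<xi> \<noteq> 0"
    then have "(1 / norm \<xi>) *\<^sub>R \<xi> \<in> K \<inter> sphere 0 1"
      using K(1) by (auto simp: cone_def)
    then have "\<mu> \<bullet> ((1 / norm \<xi>) *\<^sub>R \<xi>) > 0"
      using \<mu> b hull_inc less_trans by metis
    then show "\<mu> \<bullet> \<xi> > 0" using \<xi>(2) by (simp add: zero_less_divide_iff)
  qed
qed

text \<open>
  Minimizing \<open>l\<close> alone gives a point that may be dominated by others with the same value of \<open>l\<close>.
  A strictly positive functional breaks these ties: \<open>u\<close> minimizes it on the face \<open>E\<close> of minimizers
  of \<open>l\<close>.
\<close>

lemma compact_cone_minimal_on_face:
  fixes S :: "'a::euclidean_space set"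
  assumes "compact S" "S \<noteq> {}" "proper_cone K" "l \<in> dual_cone K"
  obtains u where "u \<in> S" "\<And>\<eta>. \<eta> \<in> S \<Longrightarrow> l \<bullet> u \<le> l \<bullet> \<eta>"
    "\<And>\<eta>. \<eta> \<in> S \<Longrightarrow> cone_le K \<eta> u \<Longrightarrow> \<eta> = u"
proof -
  obtain \<mu> where \<mu>: "\<And>\<xi>. \<xi> \<in> K \<Longrightarrow> \<xi> \<noteq> 0 \<Longrightarrow> \<mu> \<bullet> \<xi> > 0"
    using proper_cone_strictly_positive_functional[OF assms(3)] by blast
  have inner_cont: "continuous_on X (\<lambda>\<xi>. v \<bullet> \<xi>)" for X and v :: 'a
    by (intro continuous_intros)
  obtain p where p: "p \<in> S" "\<And>\<eta>. \<eta> \<in> S \<Longrightarrow> l \<bullet> p \<le> l \<bullet> \<eta>"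
    using continuous_attains_inf[OF assms(1,2) inner_cont] by metis
  define E where "E = S \<inter> {\<xi>. l \<bullet> \<xi> = l \<bullet> p}"
  have "compact E" "E \<noteq> {}"
    using assms(1) p by (auto simp: E_def intro: compact_Int_closed closed_hyperplane)
  then obtain u where u: "u \<in> E" "\<And>\<eta>. \<eta> \<in> E \<Longrightarrow> \<mu> \<bullet> u \<le> \<mu> \<bullet> \<eta>"
    using continuous_attains_inf[OF _ _ inner_cont] by metis
  show thesis
  proof
    show "u \<in> S" "\<And>\<eta>. \<eta> \<in> S \<Longrightarrow> l \<bullet> u \<le> l \<bullet> \<eta>"
      using u(1) p by (auto simp: E_def)
    fix \<eta> assume \<eta>: "\<eta> \<in> S" "cone_le K \<eta> u"
    then have uK: "u - \<eta> \<in> K" by (simp add: cone_le_def)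
    then have "l \<bullet> \<eta> \<le> l \<bullet> u"
      using assms(4) by (auto simp: dual_cone_def inner_diff_right)
    then have "\<eta> \<in> E"
      using u(1) p(2)[OF \<eta>(1)] \<eta>(1) by (auto simp: E_def)
    then have "\<mu> \<bullet> (u - \<eta>) \<le> 0"
      using u(2) by (simp add: inner_diff_right)
    then show "\<eta> = u"
      using \<mu>[OF uK] by force
  qed
qed

lemma Inf_closure_attained:
  fixes f :: "'a::topological_space \<Rightarrow> real"
  assumes "continuous_on UNIV f" "u \<in> closure X" "\<And>\<eta>. \<eta> \<in> closure X \<Longrightarrow> f u \<le> f \<eta>"
  shows "f u = (INF \<eta>\<in>X. f \<eta>)"
proof (rule antisym)
  have bdd: "bdd_below (f ` X)"
    using assms(3) closure_subset by (intro bdd_belowI2[of _ "f u"]) blast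
  have "X \<noteq> {}" using assms(2) by auto
  then show "f u \<le> (INF \<eta>\<in>X. f \<eta>)"
    using assms(3) closure_subset by (intro cINF_greatest) blast+
  have "closed {\<xi>. (INF \<eta>\<in>X. f \<eta>) \<le> f \<xi>}"
    using assms(1) by (intro closed_Collect_le continuous_on_const)
  moreover have "X \<subseteq> {\<xi>. (INF \<eta>\<in>X. f \<eta>) \<le> f \<xi>}"
    using cINF_lower[OF bdd] by auto
  ultimately have "closure X \<subseteq> {\<xi>. (INF \<eta>\<in>X. f \<eta>) \<le> f \<xi>}"
    by (rule closure_minimal[rotated])
  then show "(INF \<eta>\<in>X. f \<eta>) \<le> f u" using assms(2) by auto
qed

lemma closest_point_span_singleton:
  fixes l v :: "'a::euclidean_space"
  assumes "l \<noteq> 0"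
  shows "closest_point (span {l}) v = ((l \<bullet> v) / (l \<bullet> l)) *\<^sub>R l"
proof (rule closest_point_unique[symmetric])
  let ?p = "((l \<bullet> v) / (l \<bullet> l)) *\<^sub>R l"
  show p: "?p \<in> span {l}" by (intro span_mul span_base) simp
  show "\<forall>z\<in>span {l}. dist v ?p \<le> dist v z"
  proof
    fix z assume "z \<in> span {l}"
    then obtain c where z: "z = c *\<^sub>R l" by (auto simp: span_singleton)
    have "orthogonal (v - ?p) (?p - z)"
      using assms by (simp add: orthogonal_def z inner_diff_left inner_diff_right inner_commute)
    then have "(norm (v - z))\<^sup>2 = (norm (v - ?p))\<^sup>2 + (norm (?p - z))\<^sup>2"
      using norm_add_Pythagorean[of "v - ?p" "?p - z"] by simp
    then have "(norm (v - ?p))\<^sup>2 \<le> (norm (v - z))\<^sup>2" by simp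
    then show "dist v ?p \<le> dist v z"
      by (simp add: dist_norm power_mono_iff)
  qed
qed (auto intro: closed_span subspace_imp_convex)

section \<open>Regular representatives of controls\<close>

text \<open>
  Controls are constrained only almost everywhere, and off \<open>A\<close> nothing is known about the
  data.  A representative that is measurable on the whole line and takes all its values in \<open>A\<close> has
  the same trajectories and costs, and along it the bounds on the data hold at every time.
\<close>

definition regular_controls :: "(real ^ 'm) set \<Rightarrow> (real \<Rightarrow> real ^ 'm) set" where
  "regular_controls A = {\<beta> \<in> borel_measurable lebesgue. \<forall>s. \<beta> s \<in> A}"

lemma regular_controls_subset_controls:
  assumes "bounded A"
  shows "regular_controls A \<subseteq> controls A T"
proof
  fix \<beta> assume \<beta>: "\<beta> \<in> regular_controls A"
  obtain B where "\<And>a. a \<in> A \<Longrightarrow> norm a \<le> B"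
    using assms by (auto simp: bounded_iff)
  then show "\<beta> \<in> controls A T"
    using \<beta> unfolding controls_def regular_controls_def
    by (auto intro!: exI[of _ B] measurable_restrict_space1)
qed

lemma control_regular_representative:
  assumes "closed A" "A \<noteq> {}" "\<alpha> \<in> controls A T"
  obtains \<beta> N where "\<beta> \<in> regular_controls A" "negligible N"
    "\<And>t s. 0 < t \<Longrightarrow> s \<in> {t..T} - N \<Longrightarrow> \<beta> s = \<alpha> s"
proof -
  obtain a where a: "a \<in> A" using assms(2) by blast
  define \<gamma> where "\<gamma> s = (if s \<in> {0<..<T} then \<alpha> s else a)" for s
  define \<beta> where "\<beta> s = (if \<gamma> s \<in> A then \<gamma> s else a)" for s
  \<comment> \<open>Controls live on the open interval, so the endpoint \<open>T\<close> of \<open>{t..T}\<close> is exceptional too.\<close>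
  define N where "N = insert T {s \<in> {0<..<T}. \<alpha> s \<notin> A}"
  have [measurable]: "\<gamma> \<in> borel_measurable lebesgue"
    using assms(3) unfolding \<gamma>_def controls_def
    by (subst measurable_restrict_space_iff[symmetric]) auto
  have [measurable]: "A \<in> sets borel" using assms(1) by simp
  have "\<beta> \<in> borel_measurable lebesgue"
    unfolding \<beta>_def by measurable
  then have "\<beta> \<in> regular_controls A"
    using a by (auto simp: regular_controls_def \<beta>_def)
  moreover have "negligible N"
  proof -
    have "AE s in lebesgue_on {0<..<T}. \<alpha> s \<in> A"
      using assms(3) by (simp add: controls_def)
    then have "AE s in lebesgue. s \<in> {0<..<T} \<longrightarrow> \<alpha> s \<in> A"
      by (subst (asm) AE_restrict_space_iff) auto
    then have "{s. \<not> (s \<in> {0<..<T} \<longrightarrow> \<alpha> s \<in> A)} \<in> null_sets lebesgue"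
      by (simp add: completion.AE_iff_null_sets)
    moreover have "{s. \<not> (s \<in> {0<..<T} \<longrightarrow> \<alpha> s \<in> A)} = {s \<in> {0<..<T}. \<alpha> s \<notin> A}"
      by auto
    ultimately show ?thesis
      by (simp add: N_def negligible_iff_null_sets[symmetric])
  qed
  moreover have "\<beta> s = \<alpha> s" if "0 < t" "s \<in> {t..T} - N" for t s
    using that by (auto simp: \<beta>_def \<gamma>_def N_def)
  ultimately show thesis using that by blast
qed

section \<open>The state equation\<close>

locale control_system =
  fixes A :: "(real ^ 'm) set"
    and F :: "real ^ 'n \<Rightarrow> real ^ 'm \<Rightarrow> real ^ 'n"
    and T C :: real
  assumes A_compact: "compact A" and A_nonempty: "A \<noteq> {}"
    and F_continuous: "continuous_on (UNIV \<times> A) (\<lambda>(x, a). F x a)"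
    and F_bounded: "\<And>x a. a \<in> A \<Longrightarrow> norm (F x a) \<le> C"
    and F_lipschitz: "\<And>x y a. a \<in> A \<Longrightarrow> norm (F x a - F y a) \<le> C * norm (x - y)"
begin

lemma C_nonneg: "0 \<le> C"
  using A_nonempty F_bounded norm_ge_zero order_trans by (metis all_not_in_conv)

text \<open>
  The dynamics are continuous only on \<open>UNIV \<times> A\<close>, so the velocity is measurable as a composition
  through the subspace of the Borel space on that set.
\<close>

lemma velocity_absolutely_integrable:
  assumes \<beta>: "\<beta> \<in> regular_controls A" and y: "continuous_on {a..b} y"
  shows "(\<lambda>s. F (y s) (\<beta> s)) absolutely_integrable_on {a..b}"
proof (rule measurable_bounded_by_integrable_imp_absolutely_integrable)
  have [measurable]: "y \<in> borel_measurable (lebesgue_on {a..b})"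
    using y by (intro continuous_imp_measurable_on_sets_lebesgue) auto
  have [measurable]: "\<beta> \<in> borel_measurable (lebesgue_on {a..b})"
    using \<beta> by (auto simp: regular_controls_def intro: measurable_restrict_space1)
  have "(\<lambda>s. (y s, \<beta> s)) \<in> lebesgue_on {a..b} \<rightarrow>\<^sub>M restrict_space borel (UNIV \<times> A)"
    using \<beta> by (auto simp: measurable_restrict_space2_iff regular_controls_def)
  from measurable_compose[OF this borel_measurable_continuous_on_restrict[OF F_continuous]]
  show "(\<lambda>s. F (y s) (\<beta> s)) \<in> borel_measurable (lebesgue_on {a..b})" by simp
  show "norm (F (y s) (\<beta> s)) \<le> C" for s
    using \<beta> F_bounded by (simp add: regular_controls_def)
qed auto

lemma velocity_integrable:
  assumes "\<beta> \<in> regular_controls A" "continuous_on {a..b} y"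
  shows "(\<lambda>s. F (y s) (\<beta> s)) integrable_on {a..b}"
  using velocity_absolutely_integrable[OF assms] set_lebesgue_integral_eq_integral(1) by blast

lemma solves_state_eq_iff:
  assumes "\<beta> \<in> regular_controls A"
  shows "solves_state_eq F T x t \<beta> y \<longleftrightarrow> continuous_on {t..T} y \<and>
     (\<forall>s\<in>{t..T}. y s = x + integral {t..s} (\<lambda>r. F (y r) (\<beta> r)))"
proof -
  have "(LINT r:{t..s}|lebesgue. F (y r) (\<beta> r)) = integral {t..s} (\<lambda>r. F (y r) (\<beta> r))"
    if "continuous_on {t..T} y" "s \<in> {t..T}" for s
    using that assms
    by (intro set_lebesgue_integral_eq_integral velocity_absolutely_integrable)
      (auto elim: continuous_on_subset)
  then show ?thesis
    using velocity_absolutely_integrable[OF assms] unfolding solves_state_eq_def by auto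
qed

lemma solves_state_eq_cong_ae:
  assumes "negligible N" "\<And>s. s \<in> {t..T} - N \<Longrightarrow> \<beta> s = \<alpha> s"
  shows "solves_state_eq F T x t \<alpha> y \<longleftrightarrow> solves_state_eq F T x t \<beta> y"
proof -
  have impl: "solves_state_eq F T x t \<beta>' y"
    if eq: "\<And>s. s \<in> {t..T} - N \<Longrightarrow> \<beta>' s = \<alpha>' s" and sol: "solves_state_eq F T x t \<alpha>' y"
    for \<alpha>' \<beta>' :: "real \<Rightarrow> real ^ 'm"
  proof -
    have int: "(\<lambda>r. F (y r) (\<alpha>' r)) absolutely_integrable_on {t..T}"
      using sol by (simp add: solves_state_eq_def)
    have int': "(\<lambda>r. F (y r) (\<beta>' r)) absolutely_integrable_on {t..T}"
      by (rule absolutely_integrable_spike[OF int assms(1)]) (simp add: eq)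
    have "(LINT r:{t..s}|lebesgue. F (y r) (\<beta>' r)) = (LINT r:{t..s}|lebesgue. F (y r) (\<alpha>' r))"
      if s: "s \<in> {t..T}" for s
    proof -
      have ai: "f absolutely_integrable_on {t..s}" if "f absolutely_integrable_on {t..T}"
        for f :: "real \<Rightarrow> real ^ 'n"
        using absolutely_integrable_on_subinterval[OF that] s by simp
      show ?thesis
        unfolding set_lebesgue_integral_eq_integral(2)[OF ai[OF int]]
          set_lebesgue_integral_eq_integral(2)[OF ai[OF int']]
        by (rule integral_spike[OF assms(1)]) (use eq s in auto)
    qed
    then show ?thesis
      using sol int' by (simp add: solves_state_eq_def)
  qed
  show ?thesis
    using impl[of \<beta> \<alpha>] impl[of \<alpha> \<beta>] assms(2) by force
qed

text \<open>
  In the supremum norm weighted by \<open>1 / weight\<close> the Picard operator has Lipschitz constant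
  \<open>C / (2 * C + 1)\<close>, which is less than \<open>1 / 2\<close> whatever the length of the time interval.
\<close>

abbreviation weight :: "real \<Rightarrow> real" where
  "weight s \<equiv> exp ((2 * C + 1) * s)"

text \<open>
  The integrand is at most \<open>C * (D * weight r)\<close>, and integrating the weight divides it by the
  exponent \<open>2 * C + 1\<close>.
\<close>

lemma picard_contraction:
  assumes \<beta>: "\<beta> \<in> regular_controls A" and "t \<le> s"
    and y: "continuous_on {t..s} y" "continuous_on {t..s} z"
    and le: "\<And>r. r \<in> {t..s} \<Longrightarrow> norm (y r - z r) \<le> D * weight r"
  shows "norm (integral {t..s} (\<lambda>r. F (y r) (\<beta> r)) - integral {t..s} (\<lambda>r. F (z r) (\<beta> r)))
      \<le> D / 2 * weight s"
proof -
  have "0 \<le> D * weight t" using order_trans[OF norm_ge_zero le[of t]] \<open>t \<le> s\<close> by simp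
  then have D: "0 \<le> D" by (simp add: zero_le_mult_iff)
  have pos: "0 < 2 * C + 1" using C_nonneg by simp
  have prim: "((\<lambda>r. C * (D * weight r)) has_integral
      C * D / (2 * C + 1) * weight s - C * D / (2 * C + 1) * weight t) {t..s}"
    using \<open>t \<le> s\<close> pos
    by (intro fundamental_theorem_of_calculus)
      (auto intro!: derivative_eq_intros simp: has_real_derivative_iff_has_vector_derivative[symmetric])
  have "norm (integral {t..s} (\<lambda>r. F (y r) (\<beta> r)) - integral {t..s} (\<lambda>r. F (z r) (\<beta> r)))
      = norm (integral {t..s} (\<lambda>r. F (y r) (\<beta> r) - F (z r) (\<beta> r)))"
    using \<beta> y by (simp add: integral_diff velocity_integrable)
  also have "\<dots> \<le> integral {t..s} (\<lambda>r. C * (D * weight r))"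
  proof (rule Henstock_Kurzweil_Integration.integral_norm_bound_integral)
    show "(\<lambda>r. F (y r) (\<beta> r) - F (z r) (\<beta> r)) integrable_on {t..s}"
      using \<beta> y by (intro integrable_diff velocity_integrable)
    show "(\<lambda>r. C * (D * weight r)) integrable_on {t..s}" using prim by blast
    fix r assume r: "r \<in> {t..s}"
    have "norm (F (y r) (\<beta> r) - F (z r) (\<beta> r)) \<le> C * norm (y r - z r)"
      using \<beta> by (intro F_lipschitz) (simp add: regular_controls_def)
    also have "\<dots> \<le> C * (D * weight r)"
      using le[OF r] C_nonneg by (rule mult_left_mono)
    finally show "norm (F (y r) (\<beta> r) - F (z r) (\<beta> r)) \<le> C * (D * weight r)" .
  qed
  also have "\<dots> \<le> C * D / (2 * C + 1) * weight s"
    using D C_nonneg unfolding integral_unique[OF prim] by simp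
  also have "\<dots> \<le> D / 2 * weight s"
    using D C_nonneg pos by (intro mult_right_mono) (auto simp: field_simps)
  finally show ?thesis .
qed

text \<open>
  Let \<open>D\<close> be the weighted distance of the two solutions, attained at time \<open>m\<close>.  The contraction
  estimate there reads \<open>D * weight m \<le> norm (x - x') + D / 2 * weight m\<close>, and the last term is
  absorbed on the left.  For \<open>x = x'\<close> this is uniqueness.
\<close>

lemma state_eq_stable:
  assumes \<beta>: "\<beta> \<in> regular_controls A" and "0 \<le> t"
    and y: "solves_state_eq F T x t \<beta> y" and z: "solves_state_eq F T x' t \<beta> z"
    and s: "s \<in> {t..T}"
  shows "norm (y s - z s) \<le> 2 * weight T * norm (x - x')"
proof -
  have cont: "continuous_on {t..T} y" "continuous_on {t..T} z"
    and eq: "\<And>s. s \<in> {t..T} \<Longrightarrow> y s = x + integral {t..s} (\<lambda>r. F (y r) (\<beta> r))"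
      "\<And>s. s \<in> {t..T} \<Longrightarrow> z s = x' + integral {t..s} (\<lambda>r. F (z r) (\<beta> r))"
    using y z by (auto simp: solves_state_eq_iff[OF \<beta>])
  have "continuous_on {t..T} (\<lambda>r. norm (y r - z r) / weight r)"
    using cont by (intro continuous_intros) auto
  then obtain m where m: "m \<in> {t..T}"
    and max: "\<And>r. r \<in> {t..T} \<Longrightarrow> norm (y r - z r) / weight r \<le> norm (y m - z m) / weight m"
    using continuous_attains_sup[OF compact_Icc, of t T "\<lambda>r. norm (y r - z r) / weight r"] s by force
  define D where "D = norm (y m - z m) / weight m"
  have le: "norm (y r - z r) \<le> D * weight r" if "r \<in> {t..T}" for r
    using max[OF that] by (simp add: D_def pos_divide_le_eq)
  let ?d = "integral {t..m} (\<lambda>r. F (y r) (\<beta> r)) - integral {t..m} (\<lambda>r. F (z r) (\<beta> r))"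
  have "y m - z m = (x - x') + ?d"
    by (subst eq(1)[OF m], subst eq(2)[OF m]) simp
  then have "D * weight m = norm ((x - x') + ?d)"
    by (simp add: D_def)
  also have "\<dots> \<le> norm (x - x') + norm ?d"
    by (rule norm_triangle_ineq)
  also have "\<dots> \<le> norm (x - x') + D / 2 * weight m"
    using m cont le
    by (intro add_left_mono picard_contraction[OF \<beta>]) (auto elim: continuous_on_subset)
  finally have "D * weight m \<le> 2 * norm (x - x')" by simp
  \<comment> \<open>The weight is at least 1 because times are nonnegative.\<close>
  moreover have "D * 1 \<le> D * weight m"
    using m \<open>0 \<le> t\<close> C_nonneg by (intro mult_left_mono) (auto simp: D_def)
  ultimately have D: "D \<le> 2 * norm (x - x')" by simp
  have "norm (y s - z s) \<le> D * weight s" using le[OF s] .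
  also have "\<dots> \<le> 2 * norm (x - x') * weight T"
    using D s C_nonneg by (intro mult_mono) auto
  finally show ?thesis by (simp add: mult_ac)
qed

text \<open>
  Banach's theorem is applied to bounded continuous functions on the line, with the plain supremum
  norm.  The unknown is therefore the rescaled curve \<open>z s = y s / weight s\<close>, and the Picard operator
  \<open>P\<close> is rescaled and continued by constants outside \<open>{t..T}\<close>.
\<close>

lemma state_eq_solvable:
  assumes \<beta>: "\<beta> \<in> regular_controls A" and tT: "t \<le> T"
  shows "\<exists>y. solves_state_eq F T x t \<beta> y"
proof -
  define P where "P z s = x + integral {t..s} (\<lambda>r. F (weight r *\<^sub>R apply_bcontfun z r) (\<beta> r))"
    for z :: "real \<Rightarrow>\<^sub>C (real ^ 'n)" and s
  define G where "G z = ext_cont (\<lambda>s. (1 / weight s) *\<^sub>R P z s) t T" for z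
  have wz: "continuous_on X (\<lambda>r. weight r *\<^sub>R apply_bcontfun z r)"
    for X and z :: "real \<Rightarrow>\<^sub>C (real ^ 'n)"
    by (intro continuous_intros continuous_on_apply_bcontfun)
  have P_cont: "continuous_on {t..T} (P z)" for z
    unfolding P_def
    by (intro continuous_intros indefinite_integral_continuous_1 velocity_integrable \<beta> wz)
  then have "continuous_on {t..T} (\<lambda>s. (1 / weight s) *\<^sub>R P z s)" for z
    by (intro continuous_intros) auto
  then have G_in: "G z \<in> bcontfun" for z
    unfolding G_def bcontfun_def ext_cont_def mem_Collect_eq
    by (intro conjI clamp_continuous_on clamp_bounded)
      (auto intro: compact_imp_bounded compact_continuous_image)
  define \<Phi> where "\<Phi> z = Bcontfun (G z)" for z
  have \<Phi>: "apply_bcontfun (\<Phi> z) = G z" for z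
    unfolding \<Phi>_def by (rule Bcontfun_inverse[OF G_in])
  have "dist (\<Phi> z) (\<Phi> z') \<le> 1/2 * dist z z'" for z z'
  proof (rule dist_bound)
    fix s0
    define s where "s = clamp t T s0"
    have "s \<in> cbox t T" unfolding s_def using tT by (intro clamp_in_interval) simp
    then have s: "s \<in> {t..T}" by simp
    have "norm (P z s - P z' s) \<le> dist z z' / 2 * weight s"
      unfolding P_def add_diff_cancel_left
    proof (rule picard_contraction[OF \<beta>])
      show "norm (weight r *\<^sub>R apply_bcontfun z r - weight r *\<^sub>R apply_bcontfun z' r)
          \<le> dist z z' * weight r" for r
        using dist_bounded[of z r z']
        by (simp add: scaleR_diff_right[symmetric] dist_norm[symmetric] mult.commute)
    qed (use s wz in auto)
    then have "norm (P z s - P z' s) / weight s \<le> 1/2 * dist z z'"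
      by (simp add: pos_divide_le_eq)
    then show "dist (\<Phi> z s0) (\<Phi> z' s0) \<le> 1/2 * dist z z'"
      by (simp add: \<Phi> G_def ext_cont_def s_def[symmetric] dist_norm scaleR_diff_right[symmetric])
  qed
  then obtain z where z: "\<Phi> z = z"
    using banach_fix_type[of "1/2" \<Phi>] by auto
  define y where "y s = weight s *\<^sub>R apply_bcontfun z s" for s
  have "y s = P z s" if "s \<in> {t..T}" for s
  proof -
    have "apply_bcontfun z s = G z s" by (metis z \<Phi>)
    also have "\<dots> = (1 / weight s) *\<^sub>R P z s" using that by (simp add: G_def)
    finally show ?thesis by (simp add: y_def)
  qed
  then have "solves_state_eq F T x t \<beta> y"
    using wz[of "{t..T}" z] by (simp add: solves_state_eq_iff[OF \<beta>] P_def y_def)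
  then show ?thesis by blast
qed

lemma solves_state_eq_restrict:
  assumes "solves_state_eq F T x t \<beta> y"
  shows "solves_state_eq F T x t \<beta> (restrict y {t..T})"
proof -
  have "(LINT r:{t..s}|lebesgue. F (restrict y {t..T} r) (\<beta> r)) = (LINT r:{t..s}|lebesgue. F (y r) (\<beta> r))"
    if "s \<in> {t..T}" for s
    using that by (intro set_lebesgue_integral_cong) auto
  moreover have "set_integrable lebesgue {t..T} (\<lambda>r. F (restrict y {t..T} r) (\<beta> r))
      \<longleftrightarrow> set_integrable lebesgue {t..T} (\<lambda>r. F (y r) (\<beta> r))"
    by (intro set_integrable_cong) auto
  ultimately show ?thesis
    using assms continuous_on_cong[of "{t..T}" "{t..T}" "restrict y {t..T}" y]
    by (simp add: solves_state_eq_def)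
qed

lemma trajectory_solves:
  assumes \<beta>: "\<beta> \<in> regular_controls A" and t: "0 \<le> t" "t \<le> T"
  shows "solves_state_eq F T x t \<beta> (trajectory F T x t \<beta>)"
proof -
  obtain y where y: "solves_state_eq F T x t \<beta> y"
    using state_eq_solvable[OF \<beta> t(2)] by blast
  have "\<exists>!y. solves_state_eq F T x t \<beta> y \<and> y \<in> extensional {t..T}"
  proof (rule ex_ex1I)
    show "\<exists>y. solves_state_eq F T x t \<beta> y \<and> y \<in> extensional {t..T}"
      using solves_state_eq_restrict[OF y] restrict_extensional by blast
    fix y z assume yz: "solves_state_eq F T x t \<beta> y \<and> y \<in> extensional {t..T}"
      "solves_state_eq F T x t \<beta> z \<and> z \<in> extensional {t..T}"
    show "y = z"
    proof (rule extensionalityI)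
      show "y s = z s" if "s \<in> {t..T}" for s
        using state_eq_stable[OF \<beta> t(1) _ _ that, of x y x z] yz by simp
    qed (use yz in auto)
  qed
  from theI'[OF this] show ?thesis unfolding trajectory_def by blast
qed

lemma solution_displacement:
  assumes \<beta>: "\<beta> \<in> regular_controls A" and y: "solves_state_eq F T x t \<beta> y" and s: "s \<in> {t..T}"
  shows "norm (y s - x) \<le> C * (s - t)"
proof -
  have c: "continuous_on {t..s} y"
    using y s by (auto simp: solves_state_eq_def elim: continuous_on_subset)
  have "norm (y s - x) = norm (integral {t..s} (\<lambda>r. F (y r) (\<beta> r)))"
    using y s by (simp add: solves_state_eq_iff[OF \<beta>])
  also have "\<dots> \<le> integral {t..s} (\<lambda>r. C)"
    using \<beta> F_bounded
    by (intro Henstock_Kurzweil_Integration.integral_norm_bound_integral velocity_integrable c)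
      (auto simp: regular_controls_def)
  finally show ?thesis using s by (simp add: mult.commute)
qed

lemma solution_restart:
  assumes \<beta>: "\<beta> \<in> regular_controls A" and y: "solves_state_eq F T x t \<beta> y" and t': "t' \<in> {t..T}"
  shows "solves_state_eq F T (y t') t' \<beta> y"
  unfolding solves_state_eq_iff[OF \<beta>]
proof (intro conjI ballI)
  have c: "continuous_on {t..T} y"
    using y by (simp add: solves_state_eq_def)
  then show "continuous_on {t'..T} y" using t' by (auto elim: continuous_on_subset)
  fix s assume s: "s \<in> {t'..T}"
  have "integral {t..t'} (\<lambda>r. F (y r) (\<beta> r)) + integral {t'..s} (\<lambda>r. F (y r) (\<beta> r))
      = integral {t..s} (\<lambda>r. F (y r) (\<beta> r))"
    using s t' c
    by (intro Henstock_Kurzweil_Integration.integral_combine velocity_integrable[OF \<beta>])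
      (auto elim: continuous_on_subset)
  moreover have "y t' = x + integral {t..t'} (\<lambda>r. F (y r) (\<beta> r))"
      "y s = x + integral {t..s} (\<lambda>r. F (y r) (\<beta> r))"
    using y s t' by (auto simp: solves_state_eq_iff[OF \<beta>])
  ultimately show "y s = y t' + integral {t'..s} (\<lambda>r. F (y r) (\<beta> r))" by simp
qed

text \<open>
  At time \<open>t'\<close> the earlier trajectory has moved by at most \<open>C * (t' - t)\<close>; from then on both solve the
  same equation with different initial states.
\<close>

lemma trajectory_distance:
  assumes \<beta>: "\<beta> \<in> regular_controls A" and t: "0 \<le> t" "t \<le> t'" and s: "s \<in> {t'..T}"
  shows "norm (trajectory F T x t \<beta> s - trajectory F T x' t' \<beta> s)
    \<le> 2 * weight T * (norm (x - x') + C * (t' - t))"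
proof -
  let ?y = "trajectory F T x t \<beta>" and ?z = "trajectory F T x' t' \<beta>"
  have y: "solves_state_eq F T x t \<beta> ?y" and z: "solves_state_eq F T x' t' \<beta> ?z"
    using t s by (auto intro: trajectory_solves[OF \<beta>])
  have t': "t' \<in> {t..T}" using t s by auto
  have "norm (?y s - ?z s) \<le> 2 * weight T * norm (?y t' - x')"
    using state_eq_stable[OF \<beta> _ solution_restart[OF \<beta> y t'] z s] t by simp
  also have "norm (?y t' - x') \<le> norm (x - x') + C * (t' - t)"
    using norm_triangle_ineq[of "?y t' - x" "x - x'"] solution_displacement[OF \<beta> y t'] by simp
  finally show ?thesis by simp
qed

end

section \<open>Regularity of the cost in the initial data\<close>

locale bolza_problem = control_system A F T C
  for A :: "(real ^ 'm) set" and F :: "real ^ 'n \<Rightarrow> real ^ 'm \<Rightarrow> real ^ 'n" and T C +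
  fixes h :: "real ^ 'n \<Rightarrow> real ^ 'm \<Rightarrow> real ^ 'N"
    and g :: "real ^ 'n \<Rightarrow> real ^ 'N"
  assumes g_bounded: "\<And>x. norm (g x) \<le> C"
    and h_bounded: "\<And>x a. a \<in> A \<Longrightarrow> norm (h x a) \<le> C"
    and g_lipschitz: "\<And>x y. norm (g x - g y) \<le> C * norm (x - y)"
    and h_lipschitz: "\<And>x y a. a \<in> A \<Longrightarrow> norm (h x a - h y a) \<le> C * norm (x - y)"
    and running_cost_integrable: "cost_well_defined F h A T"
begin

lemma controls_nonempty: "controls A T \<noteq> {}"
proof -
  obtain a where "a \<in> A" using A_nonempty by blast
  then have "(\<lambda>_. a) \<in> regular_controls A" by (simp add: regular_controls_def)
  then have "(\<lambda>_. a) \<in> controls A T"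
    by (rule subsetD[OF regular_controls_subset_controls[OF compact_imp_bounded[OF A_compact]]])
  then show ?thesis by auto
qed

lemma running_cost_absolutely_integrable:
  assumes "\<alpha> \<in> controls A T" "t \<in> {0<..<T}"
  shows "(\<lambda>s. h (trajectory F T x t \<alpha> s) (\<alpha> s)) absolutely_integrable_on {t..T}"
  using running_cost_integrable assms by (auto simp: cost_well_defined_def)

lemma cost_eq:
  assumes "\<alpha> \<in> controls A T" "t \<in> {0<..<T}"
  shows "cost F h g T x t \<alpha> = g (trajectory F T x t \<alpha> T)
    + integral {t..T} (\<lambda>s. h (trajectory F T x t \<alpha> s) (\<alpha> s))"
  using set_lebesgue_integral_eq_integral(2)[OF running_cost_absolutely_integrable[OF assms]]
  by (simp add: cost_def Let_def)

text \<open>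
  Both controls are admissible, so both running costs are integrable, and along the common
  trajectory they differ only on a negligible set of times.
\<close>

lemma cost_regular_representative:
  assumes "\<alpha> \<in> controls A T"
  obtains \<beta> where "\<beta> \<in> regular_controls A" "\<beta> \<in> controls A T"
    "\<And>x t. t \<in> {0<..<T} \<Longrightarrow> cost F h g T x t \<alpha> = cost F h g T x t \<beta>"
proof -
  obtain \<beta> N where \<beta>: "\<beta> \<in> regular_controls A" and N: "negligible N"
    and eq: "\<And>t s. 0 < t \<Longrightarrow> s \<in> {t..T} - N \<Longrightarrow> \<beta> s = \<alpha> s"
    using control_regular_representative[OF compact_imp_closed[OF A_compact] A_nonempty assms] by blast
  have \<beta>c: "\<beta> \<in> controls A T"
    using \<beta> by (rule subsetD[OF regular_controls_subset_controls[OF compact_imp_bounded[OF A_compact]]])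
  have "cost F h g T x t \<alpha> = cost F h g T x t \<beta>" if t: "t \<in> {0<..<T}" for x t
  proof -
    have tr: "trajectory F T x t \<alpha> = trajectory F T x t \<beta>"
      unfolding trajectory_def using t
      by (subst solves_state_eq_cong_ae[OF N eq, of t]) auto
    have "integral {t..T} (\<lambda>s. h (trajectory F T x t \<beta> s) (\<alpha> s))
        = integral {t..T} (\<lambda>s. h (trajectory F T x t \<beta> s) (\<beta> s))"
      by (rule integral_spike[OF N]) (use eq t in auto)
    then show ?thesis
      using cost_eq[OF assms t] cost_eq[OF \<beta>c t] by (simp add: tr)
  qed
  then show thesis using that \<beta> \<beta>c by blast
qed

lemma cost_bounded:
  assumes "\<alpha> \<in> controls A T" "t \<in> {0<..<T}"
  shows "norm (cost F h g T x t \<alpha>) \<le> C + C * T"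
proof -
  obtain \<beta> where \<beta>: "\<beta> \<in> regular_controls A" "\<beta> \<in> controls A T"
    and eq: "cost F h g T x t \<alpha> = cost F h g T x t \<beta>"
    using cost_regular_representative[OF assms(1)] assms(2) by metis
  have "norm (integral {t..T} (\<lambda>s. h (trajectory F T x t \<beta> s) (\<beta> s))) \<le> integral {t..T} (\<lambda>s. C)"
    using \<beta> h_bounded assms(2)
    by (intro Henstock_Kurzweil_Integration.integral_norm_bound_integral
        set_lebesgue_integral_eq_integral(1) running_cost_absolutely_integrable)
      (auto simp: regular_controls_def)
  also have "\<dots> = C * (T - t)" using assms(2) by simp
  also have "\<dots> \<le> C * T" using assms(2) C_nonneg by (intro mult_left_mono) auto
  finally show ?thesis
    unfolding eq cost_eq[OF \<beta>(2) assms(2)] by (intro norm_triangle_mono g_bounded)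
qed

text \<open>
  With \<open>d = norm (x - x') + \<bar>t - t'\<bar>\<close>, trajectories differ by at most \<open>2 * weight T * (1 + C) * d\<close>.
  The terminal cost and the running cost on the common time interval multiply this by \<open>C\<close> and
  \<open>T * C\<close>; the running cost between the two initial times accounts for the last summand.
\<close>

definition cost_modulus :: real where
  "cost_modulus = (C + T * C) * (2 * weight T) * (1 + C) + C"

text \<open>
  The same control can be used from both initial times because controls are defined on all of
  \<open>(0,T)\<close>.  The cost difference splits into a terminal part, the running cost incurred before \<open>t'\<close>,
  and the difference of the running costs after \<open>t'\<close>.
\<close>

lemma cost_lipschitz_ordered:
  assumes \<alpha>: "\<alpha> \<in> controls A T" and t: "t \<in> {0<..<T}" "t' \<in> {0<..<T}" "t \<le> t'"
  shows "norm (cost F h g T x t \<alpha> - cost F h g T x' t' \<alpha>)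
    \<le> cost_modulus * (norm (x - x') + (t' - t))"
proof -
  obtain \<beta> where \<beta>: "\<beta> \<in> regular_controls A" "\<beta> \<in> controls A T"
    and eq: "\<And>x t. t \<in> {0<..<T} \<Longrightarrow> cost F h g T x t \<alpha> = cost F h g T x t \<beta>"
    using cost_regular_representative[OF \<alpha>] by blast
  define y where "y = trajectory F T x t \<beta>"
  define z where "z = trajectory F T x' t' \<beta>"
  define E where "E = 2 * weight T * (norm (x - x') + C * (t' - t))"
  have \<beta>A: "\<beta> s \<in> A" for s using \<beta> by (simp add: regular_controls_def)
  have E: "norm (y s - z s) \<le> E" if "s \<in> {t'..T}" for s
    unfolding y_def z_def E_def using trajectory_distance[OF \<beta>(1) _ t(3) that] t by simp
  have E0: "0 \<le> E"
    using t C_nonneg by (simp add: E_def)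
  have hy: "(\<lambda>s. h (y s) (\<beta> s)) integrable_on {t..T}" and hz: "(\<lambda>s. h (z s) (\<beta> s)) integrable_on {t'..T}"
    unfolding y_def z_def using \<beta> t
    by (auto intro!: set_lebesgue_integral_eq_integral(1) running_cost_absolutely_integrable)
  have hy1: "(\<lambda>s. h (y s) (\<beta> s)) integrable_on {t..t'}" and hy2: "(\<lambda>s. h (y s) (\<beta> s)) integrable_on {t'..T}"
    using integrable_on_subinterval[OF hy] t by auto
  have split: "integral {t..T} (\<lambda>s. h (y s) (\<beta> s))
      = integral {t..t'} (\<lambda>s. h (y s) (\<beta> s)) + integral {t'..T} (\<lambda>s. h (y s) (\<beta> s))"
    using t hy by (intro Henstock_Kurzweil_Integration.integral_combine[symmetric]) auto
  have early: "norm (integral {t..t'} (\<lambda>s. h (y s) (\<beta> s))) \<le> C * (t' - t)"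
  proof -
    have "norm (integral {t..t'} (\<lambda>s. h (y s) (\<beta> s))) \<le> integral {t..t'} (\<lambda>s. C)"
      using hy1 h_bounded \<beta>A
      by (intro Henstock_Kurzweil_Integration.integral_norm_bound_integral) auto
    then show ?thesis using t by (simp add: mult.commute)
  qed
  have late: "norm (integral {t'..T} (\<lambda>s. h (y s) (\<beta> s)) - integral {t'..T} (\<lambda>s. h (z s) (\<beta> s)))
      \<le> T * (C * E)"
  proof -
    have "norm (integral {t'..T} (\<lambda>s. h (y s) (\<beta> s)) - integral {t'..T} (\<lambda>s. h (z s) (\<beta> s)))
        = norm (integral {t'..T} (\<lambda>s. h (y s) (\<beta> s) - h (z s) (\<beta> s)))"
      using hy2 hz by (simp add: integral_diff)
    also have "\<dots> \<le> integral {t'..T} (\<lambda>s. C * E)"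
    proof (rule Henstock_Kurzweil_Integration.integral_norm_bound_integral)
      show "norm (h (y s) (\<beta> s) - h (z s) (\<beta> s)) \<le> C * E" if "s \<in> {t'..T}" for s
        using h_lipschitz[OF \<beta>A, of "y s" s "z s"] mult_left_mono[OF E[OF that] C_nonneg] by linarith
    qed (use hy2 hz in \<open>auto intro: integrable_diff\<close>)
    also have "\<dots> = (T - t') * (C * E)" using t by simp
    also have "\<dots> \<le> T * (C * E)"
      using t E0 C_nonneg by (intro mult_right_mono) auto
    finally show ?thesis .
  qed
  have final: "norm (g (y T) - g (z T)) \<le> C * E"
    using g_lipschitz[of "y T" "z T"] mult_left_mono[OF E C_nonneg, of T] t by force
  have "cost F h g T x t \<alpha> - cost F h g T x' t' \<alpha> = (g (y T) - g (z T))
      + integral {t..t'} (\<lambda>s. h (y s) (\<beta> s))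
      + (integral {t'..T} (\<lambda>s. h (y s) (\<beta> s)) - integral {t'..T} (\<lambda>s. h (z s) (\<beta> s)))"
    using t split by (simp add: eq cost_eq[OF \<beta>(2)] y_def[symmetric] z_def[symmetric])
  then have "norm (cost F h g T x t \<alpha> - cost F h g T x' t' \<alpha>) \<le> C * E + C * (t' - t) + T * (C * E)"
    using final early late by (auto intro!: norm_triangle_mono)
  also have "\<dots> = (C + T * C) * E + C * (t' - t)" by (simp add: algebra_simps)
  also have "\<dots> \<le> (C + T * C) * (2 * weight T * ((1 + C) * (norm (x - x') + (t' - t))))
      + C * (norm (x - x') + (t' - t))"
  proof -
    have "0 \<le> C * norm (x - x')" "0 \<le> T * C" using C_nonneg t by auto
    then have "norm (x - x') + C * (t' - t) \<le> (1 + C) * (norm (x - x') + (t' - t))"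
      using t by (simp add: algebra_simps)
    then show ?thesis
      unfolding E_def using C_nonneg t \<open>0 \<le> T * C\<close> by (intro add_mono mult_left_mono) auto
  qed
  also have "\<dots> = cost_modulus * (norm (x - x') + (t' - t))"
    by (simp add: cost_modulus_def algebra_simps)
  finally show ?thesis .
qed

lemma cost_lipschitz:
  assumes "\<alpha> \<in> controls A T" "t \<in> {0<..<T}" "t' \<in> {0<..<T}"
  shows "norm (cost F h g T x t \<alpha> - cost F h g T x' t' \<alpha>)
    \<le> cost_modulus * (norm (x - x') + \<bar>t - t'\<bar>)"
proof (cases "t \<le> t'")
  case True
  then show ?thesis using cost_lipschitz_ordered[OF assms, of x x'] by simp
next
  case False
  then show ?thesis
    using cost_lipschitz_ordered[OF assms(1,3,2), of x' x] by (simp add: norm_minus_commute)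
qed

lemma attainable_costs_compact: "t \<in> {0<..<T} \<Longrightarrow> compact (attainable_costs F h g A T x t)"
  unfolding attainable_costs_def using cost_bounded
  by (auto simp: compact_closure intro: boundedI)

lemma attainable_costs_nonempty: "attainable_costs F h g A T x t \<noteq> {}"
  using controls_nonempty by (simp add: attainable_costs_def)

definition scalar_value :: "real ^ 'N \<Rightarrow> real ^ 'n \<Rightarrow> real \<Rightarrow> real" where
  "scalar_value l x t = (INF \<alpha>\<in>controls A T. l \<bullet> cost F h g T x t \<alpha>)"

lemma scalar_cost_bounded:
  assumes "\<alpha> \<in> controls A T" "t \<in> {0<..<T}"
  shows "\<bar>l \<bullet> cost F h g T x t \<alpha>\<bar> \<le> norm l * (C + C * T)"
  using Cauchy_Schwarz_ineq2[of l "cost F h g T x t \<alpha>"]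
    mult_left_mono[OF cost_bounded[OF assms, of x] norm_ge_zero[of l]] by linarith

lemma scalar_cost_bdd_below:
  assumes "t \<in> {0<..<T}"
  shows "bdd_below ((\<lambda>\<alpha>. l \<bullet> cost F h g T x t \<alpha>) ` controls A T)"
  using scalar_cost_bounded[OF _ assms]
  by (intro bdd_belowI2[of _ "- (norm l * (C + C * T))"]) (smt (verit))

lemma scalar_value_bounded:
  assumes "t \<in> {0<..<T}"
  shows "\<bar>scalar_value l x t\<bar> \<le> norm l * (C + C * T)"
proof -
  obtain \<alpha> where \<alpha>: "\<alpha> \<in> controls A T" using controls_nonempty by blast
  have "scalar_value l x t \<le> norm l * (C + C * T)"
    unfolding scalar_value_def
    using scalar_cost_bounded[OF \<alpha> assms, of l x]
    by (intro cINF_lower2[OF scalar_cost_bdd_below[OF assms] \<alpha>]) simp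
  moreover have "- (norm l * (C + C * T)) \<le> scalar_value l x t"
    unfolding scalar_value_def using scalar_cost_bounded[OF _ assms]
    by (intro cINF_greatest controls_nonempty) (smt (verit))
  ultimately show ?thesis by linarith
qed

text \<open>
  A Lipschitz bound that is uniform over a family passes to the infimum; exchanging the two points
  gives the other half.
\<close>

lemma scalar_value_le:
  assumes "t \<in> {0<..<T}" "t' \<in> {0<..<T}"
  shows "scalar_value l x t \<le> scalar_value l x' t'
    + norm l * (cost_modulus * (norm (x - x') + \<bar>t - t'\<bar>))"
proof -
  let ?d = "norm l * (cost_modulus * (norm (x - x') + \<bar>t - t'\<bar>))"
  have "scalar_value l x t - ?d \<le> l \<bullet> cost F h g T x' t' \<alpha>" if \<alpha>: "\<alpha> \<in> controls A T" for \<alpha>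
  proof -
    have "scalar_value l x t \<le> l \<bullet> cost F h g T x t \<alpha>"
      unfolding scalar_value_def by (rule cINF_lower[OF scalar_cost_bdd_below[OF assms(1)] \<alpha>])
    also have "\<dots> - l \<bullet> cost F h g T x' t' \<alpha> = l \<bullet> (cost F h g T x t \<alpha> - cost F h g T x' t' \<alpha>)"
      by (simp add: inner_diff_right)
    also have "\<dots> \<le> norm l * norm (cost F h g T x t \<alpha> - cost F h g T x' t' \<alpha>)"
      by (rule norm_cauchy_schwarz)
    also have "\<dots> \<le> ?d"
      by (intro mult_left_mono cost_lipschitz \<alpha> assms) simp
    finally show ?thesis by simp
  qed
  then have "scalar_value l x t - ?d \<le> scalar_value l x' t'"
    unfolding scalar_value_def[of l x' t'] by (intro cINF_greatest controls_nonempty)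
  then show ?thesis by simp
qed

lemma scalar_value_lipschitz:
  assumes "0 < T"
  shows "(norm l * (cost_modulus * 2))-lipschitz_on (UNIV \<times> {0<..<T}) (\<lambda>(x, t). scalar_value l x t)"
proof (rule lipschitz_onI)
  have m: "0 \<le> cost_modulus"
    using C_nonneg assms by (simp add: cost_modulus_def)
  then show "0 \<le> norm l * (cost_modulus * 2)" by simp
  fix p q :: "(real ^ 'n) \<times> real" assume pq: "p \<in> UNIV \<times> {0<..<T}" "q \<in> UNIV \<times> {0<..<T}"
  obtain x t x' t' where p: "p = (x, t)" and q: "q = (x', t')" by fastforce
  have "\<bar>scalar_value l x t - scalar_value l x' t'\<bar>
      \<le> norm l * (cost_modulus * (norm (x - x') + \<bar>t - t'\<bar>))"
    using scalar_value_le[of t t' l x x'] scalar_value_le[of t' t l x' x] pq p q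
    by (simp add: norm_minus_commute abs_minus_commute)
  also have "\<dots> \<le> norm l * (cost_modulus * (2 * dist p q))"
    using dist_fst_le[of p q] dist_snd_le[of p q] m
    by (intro mult_left_mono) (auto simp: p q dist_norm)
  finally show "dist ((\<lambda>(x, t). scalar_value l x t) p) ((\<lambda>(x, t). scalar_value l x t) q)
      \<le> norm l * (cost_modulus * 2) * dist p q"
    by (simp add: p q dist_norm mult.assoc)
qed

end

section \<open>Pareto minimal value maps\<close>

text \<open>
  The selection \<open>u\<close> need not be regular in any way: \<open>l\<close> takes the same value at all its minimizers.
\<close>

theorem proposition3p4:
  fixes A :: "(real ^ 'm) set"
    and F :: "real ^ 'n \<Rightarrow> real ^ 'm \<Rightarrow> real ^ 'n"
    and h :: "real ^ 'n \<Rightarrow> real ^ 'm \<Rightarrow> real ^ 'N"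
    and g :: "real ^ 'n \<Rightarrow> real ^ 'N"
    and K :: "(real ^ 'N) set"
    and T C :: real
    and l :: "real ^ 'N"
  assumes "T > 0"
    and "compact A" and "A \<noteq> {}"
    and "continuous_on (UNIV \<times> A) (\<lambda>(x, a). F x a)"
    and "\<And>x a. a \<in> A \<Longrightarrow> norm (F x a) \<le> C"
    and "\<And>x. norm (g x) \<le> C"
    and "\<And>x a. a \<in> A \<Longrightarrow> norm (h x a) \<le> C"
    and "\<And>x y a. a \<in> A \<Longrightarrow> norm (F x a - F y a) \<le> C * norm (x - y)"
    and "\<And>x y. norm (g x - g y) \<le> C * norm (x - y)"
    and "\<And>x y a. a \<in> A \<Longrightarrow> norm (h x a - h y a) \<le> C * norm (x - y)"
    and "cost_well_defined F h A T"
    and "proper_cone K"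
    and "l \<in> dual_cone K"
  shows "\<exists>u :: real ^ 'n \<Rightarrow> real \<Rightarrow> real ^ 'N.
      pareto_minimal K F h g A T u \<and>
      (\<forall>x. \<forall>t\<in>{0<..<T}. l \<bullet> u x t = (INF \<alpha>\<in>controls A T. l \<bullet> cost F h g T x t \<alpha>)) \<and>
      (l \<noteq> 0 \<longrightarrow> (\<forall>x. \<forall>t\<in>{0<..<T}. \<exists>H.
         supporting_hyperplane_normal_to (attainable_costs F h g A T x t) H l \<and> u x t \<in> H \<and>
         closest_point (span {l}) (u x t) = ((l \<bullet> u x t) / (l \<bullet> l)) *\<^sub>R l)) \<and>
      bounded ((\<lambda>(x, t). l \<bullet> u x t) ` (UNIV \<times> {0<..<T})) \<and>
      (\<exists>L. L-lipschitz_on (UNIV \<times> {0<..<T}) (\<lambda>(x, t). l \<bullet> u x t))"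
proof -
  interpret bolza_problem A F T C h g
    using assms by unfold_locales auto
  define minimizes where "minimizes x t v \<longleftrightarrow> v \<in> attainable_costs F h g A T x t
      \<and> (\<forall>\<eta>\<in>attainable_costs F h g A T x t. l \<bullet> v \<le> l \<bullet> \<eta>)
      \<and> (\<forall>\<eta>\<in>attainable_costs F h g A T x t. cone_le K \<eta> v \<longrightarrow> \<eta> = v)" for x t v
  define u where "u x t = (SOME v. minimizes x t v)" for x t
  have u: "minimizes x t (u x t)" if "t \<in> {0<..<T}" for x t
  proof -
    have "\<exists>v. minimizes x t v"
      unfolding minimizes_def
      using compact_cone_minimal_on_face[OF attainable_costs_compact[OF that]
          attainable_costs_nonempty assms(12,13)] by metis
    then show ?thesis unfolding u_def by (rule someI_ex)
  qed
  have u_value: "l \<bullet> u x t = scalar_value l x t" if "t \<in> {0<..<T}" for x t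
  proof -
    have "continuous_on UNIV (\<lambda>\<xi>. l \<bullet> \<xi>)" by (intro continuous_intros)
    from Inf_closure_attained[OF this, of "u x t" "cost F h g T x t ` controls A T"] show ?thesis
      using u[OF that, of x]
      by (simp add: minimizes_def attainable_costs_def scalar_value_def image_comp comp_def)
  qed
  show ?thesis
  proof (intro exI[of _ u] conjI allI ballI impI)
    show "pareto_minimal K F h g A T u"
      using u by (auto simp: pareto_minimal_def minimizes_def)
    show "l \<bullet> u x t = (INF \<alpha>\<in>controls A T. l \<bullet> cost F h g T x t \<alpha>)" if "t \<in> {0<..<T}" for x t
      using u_value[OF that] by (simp add: scalar_value_def)
    show "\<exists>H. supporting_hyperplane_normal_to (attainable_costs F h g A T x t) H l \<and> u x t \<in> H \<and>
        closest_point (span {l}) (u x t) = ((l \<bullet> u x t) / (l \<bullet> l)) *\<^sub>R l"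
      if "l \<noteq> 0" "t \<in> {0<..<T}" for x t
      using u[OF that(2), of x] that(1)
      by (intro exI[of _ "{\<xi>. l \<bullet> \<xi> = l \<bullet> u x t}"])
        (auto simp: supporting_hyperplane_normal_to_def minimizes_def closest_point_span_singleton)
    show "bounded ((\<lambda>(x, t). l \<bullet> u x t) ` (UNIV \<times> {0<..<T}))"
      using u_value scalar_value_bounded[of _ l]
      by (intro boundedI[of _ "norm l * (C + C * T)"]) auto
    show "\<exists>L. L-lipschitz_on (UNIV \<times> {0<..<T}) (\<lambda>(x, t). l \<bullet> u x t)"
      by (rule exI, rule lipschitz_on_transform[OF scalar_value_lipschitz[OF assms(1), of l]])
        (use u_value in auto)
  qed
qed

end
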